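(* Let $\lambda\in\mathbb{R}$, $\alpha,\beta\in2\mathbb{Z}_{>0}$ and $\rho,\sigma\in\mathbb{R}_{\ge3}$. For $x\in\mathbb{C}$ with $|\mathrm{Re}(x)|\le2$ put $$\phi_\lambda(x)=\int_0^1f_\lambda\bigl(1+x+\tfrac{y}{\tau};\beta,\sigma\bigr)\,\overline{f_\lambda\bigl(\tfrac{y}{\tau};\alpha,\rho\bigr)}\,dy .$$ Then for generic $x\in i\mathbb{R}$ (namely, all $x\in i\mathbb{R}$ with $q^{2x}\ne1$), $$B(x)\phi_\lambda(x+2)+C(x)\phi_\lambda(x)+D(x)\phi_\lambda(x-2)=E(\lambda)\,\phi_\lambda(x),$$ where $$E(\lambda)=-1-q^{2-2\beta}+q^{1-\beta}(q^{2i\lambda}+q^{-2i\lambda}).$$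
   Context: Here $\tau\in i\mathbb{R}_{>0}$, $q=\exp(2\pi i\tau)\in(0,1)$, $q^u=\exp(2\pi i\tau u)$ for $u\in\mathbb{C}$, and $(b;q^2)_\infty=\prod_{j\ge0}(1-bq^{2j})$. Define the meromorphic function $\Gamma_{2\tau}(x)=\dfrac{q^{-x^2/8}}{(-q^{x+1};q^2)_\infty}$, and $$f_\lambda(z;\alpha,\rho)=\frac{\Gamma_{2\tau}\bigl(-1-\frac1{2\tau}+\alpha+\rho-i\lambda+z\bigr)\,\Gamma_{2\tau}\bigl(-\frac1{2\tau}+\rho-i\lambda-z\bigr)}{\Gamma_{2\tau}\bigl(1-\frac1{2\tau}+\alpha+\rho+i\lambda-z\bigr)\,\Gamma_{2\tau}\bigl(-\frac1{2\tau}+\rho+i\lambda+z\bigr)}.$$ Set $(a,b,c,d)=(1+\rho+\sigma,\,1-\rho+\sigma,\,1+\alpha+\rho-\beta-\sigma,\,1-\alpha-\rho-\beta-\sigma)$ and $$A(x)=\frac{(1-q^{a+x})(1-q^{b+x})(1-q^{c+x})(1-q^{d+x})}{(1-q^{2x})(1-q^{2+2x})},\qquad C(x)=-A(x)-A(-x),$$ $$B(x)=q^{-\beta}\frac{(1-q^{a+x})(1-q^{2-a+x})(1-q^{b+x})(1-q^{2-b+x})}{(1-q^{2x})(1-q^{2+2x})},$$ $$D(x)=q^{-\beta}\frac{(1-q^{c-x})(1-q^{2-c-x})(1-q^{d-x})(1-q^{2-d-x})}{(1-q^{-2x})(1-q^{2-2x})}.$$ *)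

theory Defs
  imports "HOL-Analysis.Analysis"
begin

text \<open>
  The base is q = exp (2 * pi * i * tau); all its powers are taken with respect to tau, so
  \<open>qpow \<tau> u\<close> stands for \<open>q\<^sup>u\<close> and \<open>qpow \<tau> 1\<close> for \<open>q\<close>.
\<close>

definition qpow :: "complex \<Rightarrow> complex \<Rightarrow> complex" where
  "qpow \<tau> u = exp (2 * of_real pi * \<i> * \<tau> * u)"

text \<open>The infinite product \<open>(b; p)\<^sub>\<infinity>\<close>; \<open>prodinf\<close> also covers products with vanishing factors.\<close>

definition qPoch_inf :: "complex \<Rightarrow> complex \<Rightarrow> complex" where
  "qPoch_inf b p = (\<Prod>j. 1 - b * p ^ j)"

text \<open>
  The function \<open>\<Gamma>\<^sub>2\<^sub>\<tau>\<close>, which is meromorphic without zeros. Its value at a pole is \<open>0\<close>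
  by the convention for division by zero. In a denominator this agrees with the entire
  function \<open>1 / \<Gamma>\<^sub>2\<^sub>\<tau>\<close>, which vanishes there.
\<close>

definition Gamma_2tau :: "complex \<Rightarrow> complex \<Rightarrow> complex" where
  "Gamma_2tau \<tau> x = qpow \<tau> (- (x\<^sup>2) / 8) / qPoch_inf (- qpow \<tau> (x + 1)) ((qpow \<tau> 1)\<^sup>2)"

definition f_fun :: "complex \<Rightarrow> complex \<Rightarrow> complex \<Rightarrow> complex \<Rightarrow> complex \<Rightarrow> complex" where
  "f_fun \<tau> lam z \<alpha> \<rho> =
     (Gamma_2tau \<tau> (- 1 - 1 / (2 * \<tau>) + \<alpha> + \<rho> - \<i> * lam + z) *
      Gamma_2tau \<tau> (- (1 / (2 * \<tau>)) + \<rho> - \<i> * lam - z)) /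
     (Gamma_2tau \<tau> (1 - 1 / (2 * \<tau>) + \<alpha> + \<rho> + \<i> * lam - z) *
      Gamma_2tau \<tau> (- (1 / (2 * \<tau>)) + \<rho> + \<i> * lam + z))"

text \<open>
  The poles of \<open>f_fun \<tau> lam z \<alpha> \<rho>\<close>, for real \<open>lam\<close>, \<open>\<alpha>\<close>, \<open>\<rho>\<close>, lie on the lines
  \<open>Re z = - \<alpha> - \<rho> - 2 j\<close> and \<open>Re z = 1 + \<rho> + 2 j\<close> with \<open>j \<ge> 0\<close>. For \<open>\<alpha>, \<beta> > 0\<close>, \<open>\<rho>, \<sigma> \<ge> 3\<close>
  and \<open>\<bar>Re x\<bar> \<le> 2\<close> the integrand below is therefore continuous on \<open>[0, 1]\<close>.
\<close>

definition phi_fun ::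
  "complex \<Rightarrow> complex \<Rightarrow> complex \<Rightarrow> complex \<Rightarrow> complex \<Rightarrow> complex \<Rightarrow> complex \<Rightarrow> complex" where
  "phi_fun \<tau> \<alpha> \<beta> \<rho> \<sigma> lam x =
     integral {0..1::real}
       (\<lambda>y. f_fun \<tau> lam (1 + x + of_real y / \<tau>) \<beta> \<sigma> *
            cnj (f_fun \<tau> lam (of_real y / \<tau>) \<alpha> \<rho>))"

definition par_a :: "complex \<Rightarrow> complex \<Rightarrow> complex" where
  "par_a \<rho> \<sigma> = 1 + \<rho> + \<sigma>"

definition par_b :: "complex \<Rightarrow> complex \<Rightarrow> complex" where
  "par_b \<rho> \<sigma> = 1 - \<rho> + \<sigma>"

definition par_c :: "complex \<Rightarrow> complex \<Rightarrow> complex \<Rightarrow> complex \<Rightarrow> complex" where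
  "par_c \<alpha> \<beta> \<rho> \<sigma> = 1 + \<alpha> + \<rho> - \<beta> - \<sigma>"

definition par_d :: "complex \<Rightarrow> complex \<Rightarrow> complex \<Rightarrow> complex \<Rightarrow> complex" where
  "par_d \<alpha> \<beta> \<rho> \<sigma> = 1 - \<alpha> - \<rho> - \<beta> - \<sigma>"

definition A_coeff ::
  "complex \<Rightarrow> complex \<Rightarrow> complex \<Rightarrow> complex \<Rightarrow> complex \<Rightarrow> complex \<Rightarrow> complex" where
  "A_coeff \<tau> \<alpha> \<beta> \<rho> \<sigma> x =
     (let a = par_a \<rho> \<sigma>; b = par_b \<rho> \<sigma>; c = par_c \<alpha> \<beta> \<rho> \<sigma>; d = par_d \<alpha> \<beta> \<rho> \<sigma> in
       ((1 - qpow \<tau> (a + x)) * (1 - qpow \<tau> (b + x)) *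
        (1 - qpow \<tau> (c + x)) * (1 - qpow \<tau> (d + x))) /
       ((1 - qpow \<tau> (2 * x)) * (1 - qpow \<tau> (2 + 2 * x))))"

definition C_coeff ::
  "complex \<Rightarrow> complex \<Rightarrow> complex \<Rightarrow> complex \<Rightarrow> complex \<Rightarrow> complex \<Rightarrow> complex" where
  "C_coeff \<tau> \<alpha> \<beta> \<rho> \<sigma> x = - A_coeff \<tau> \<alpha> \<beta> \<rho> \<sigma> x - A_coeff \<tau> \<alpha> \<beta> \<rho> \<sigma> (- x)"

definition B_coeff ::
  "complex \<Rightarrow> complex \<Rightarrow> complex \<Rightarrow> complex \<Rightarrow> complex \<Rightarrow> complex" where
  "B_coeff \<tau> \<beta> \<rho> \<sigma> x =
     (let a = par_a \<rho> \<sigma>; b = par_b \<rho> \<sigma> in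
       qpow \<tau> (- \<beta>) *
       (((1 - qpow \<tau> (a + x)) * (1 - qpow \<tau> (2 - a + x)) *
         (1 - qpow \<tau> (b + x)) * (1 - qpow \<tau> (2 - b + x))) /
        ((1 - qpow \<tau> (2 * x)) * (1 - qpow \<tau> (2 + 2 * x)))))"

definition D_coeff ::
  "complex \<Rightarrow> complex \<Rightarrow> complex \<Rightarrow> complex \<Rightarrow> complex \<Rightarrow> complex \<Rightarrow> complex" where
  "D_coeff \<tau> \<alpha> \<beta> \<rho> \<sigma> x =
     (let c = par_c \<alpha> \<beta> \<rho> \<sigma>; d = par_d \<alpha> \<beta> \<rho> \<sigma> in
       qpow \<tau> (- \<beta>) *
       (((1 - qpow \<tau> (c - x)) * (1 - qpow \<tau> (2 - c - x)) *
         (1 - qpow \<tau> (d - x)) * (1 - qpow \<tau> (2 - d - x))) /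
        ((1 - qpow \<tau> (- 2 * x)) * (1 - qpow \<tau> (2 - 2 * x)))))"

definition E_val :: "complex \<Rightarrow> complex \<Rightarrow> complex \<Rightarrow> complex" where
  "E_val \<tau> \<beta> lam =
     - 1 - qpow \<tau> (2 - 2 * \<beta>) +
     qpow \<tau> (1 - \<beta>) * (qpow \<tau> (2 * \<i> * lam) + qpow \<tau> (- 2 * \<i> * lam))"

end

(*
  Up to a constant factor, phi(x) is the integral of S(x, z) = F(1 + x + z) g(z) over one period
  z = y / tau, 0 <= y <= 1, of the imaginary axis; here F and g are quotients of q-shifted
  factorials, so S is q-hypergeometric in both variables under shifts by 2. Creative telescoping
  produces a function H of z with

    B(x) S(x+2, z) + (C(x) - E) S(x, z) + D(x) S(x-2, z) = H(z + 2) - H(z).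

  H has period 1 / tau (because alpha and beta are even) and is holomorphic on a strip around
  0 <= Re z <= 2 (because rho, sigma >= 3), so its integrals over the lines Re z = 0 and Re z = 2
  agree and the right-hand side integrates to 0.
*)
theory Submission
  imports Defs "HOL-Complex_Analysis.Complex_Analysis"
begin

text \<open>As written, the integrand is not holomorphic because of the conjugation. On the
  imaginary axis, however, \<open>cnj z = - z\<close>, and since q is real, conjugation otherwise
  only replaces \<lambda> by -\<lambda>. The second factor therefore agrees there with the
  holomorphic function \<open>F \<alpha> \<rho> (- lam) (- z)\<close>, and only this makes it
  possible to move the line. In the passage from f to F the four Gaussian exponents lose their
  quadratic parts and leave q^(-\<alpha> z/2). All other factors have period 1/\<tau>, so evenness
  of \<alpha> and \<beta> enters exactly there. The algebraic core is an identity of rational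
  functions in eight independent quantities. Reading it modulo two quadratic factors breaks it into
  pieces that polynomial arithmetic can decide.\<close>

subsection \<open>The infinite q-shifted factorial\<close>

lemma summable_qPoch_factor:
  assumes "cmod p < 1"
  shows "summable (\<lambda>j. cmod (b * p ^ j :: complex))"
  using assms by (simp add: norm_mult norm_power summable_mult summable_geometric)

lemma convergent_prod_qPoch:
  assumes "cmod p < 1"
  shows "convergent_prod (\<lambda>j. 1 - b * p ^ j :: complex)"
proof (rule abs_convergent_prod_imp_convergent_prod)
  show "abs_convergent_prod (\<lambda>j. 1 - b * p ^ j)"
    using summable_qPoch_factor[OF assms, of b] by (simp add: abs_convergent_prod_conv_summable)
qed

text \<open>The recurrence and the conjugation rule below are read off from the finite products by
  uniqueness of limits; this treats products with a vanishing factor on the same footing.\<close>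

lemma LIMSEQ_qPoch_inf:
  assumes "cmod p < 1"
  shows "(\<lambda>n. \<Prod>j<n. 1 - b * p ^ j) \<longlonglongrightarrow> qPoch_inf b p"
proof -
  have "(\<lambda>n. \<Prod>j<Suc n. 1 - b * p ^ j) \<longlonglongrightarrow> qPoch_inf b p"
    using convergent_prod_LIMSEQ[OF convergent_prod_qPoch[OF assms, of b]]
    by (simp add: qPoch_inf_def lessThan_Suc_atMost)
  then show ?thesis
    by (rule LIMSEQ_imp_Suc)
qed

lemma qPoch_inf_rec:
  assumes "cmod p < 1"
  shows "qPoch_inf b p = (1 - b) * qPoch_inf (b * p) p"
proof (rule LIMSEQ_unique)
  show "(\<lambda>n. \<Prod>j<Suc n. 1 - b * p ^ j) \<longlonglongrightarrow> qPoch_inf b p"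
    by (rule LIMSEQ_Suc[OF LIMSEQ_qPoch_inf[OF assms]])
  have "(\<lambda>n. (1 - b) * (\<Prod>j<n. 1 - b * p * p ^ j)) \<longlonglongrightarrow> (1 - b) * qPoch_inf (b * p) p"
    by (intro tendsto_intros LIMSEQ_qPoch_inf assms)
  then show "(\<lambda>n. \<Prod>j<Suc n. 1 - b * p ^ j) \<longlonglongrightarrow> (1 - b) * qPoch_inf (b * p) p"
    by (simp add: prod.lessThan_Suc_shift mult.assoc del: prod.lessThan_Suc)
qed

lemma cnj_qPoch_inf:
  assumes "cmod p < 1"
  shows "cnj (qPoch_inf b p) = qPoch_inf (cnj b) (cnj p)"
proof (rule LIMSEQ_unique)
  show "(\<lambda>n. \<Prod>j<n. 1 - cnj b * cnj p ^ j) \<longlonglongrightarrow> cnj (qPoch_inf b p)"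
    using tendsto_cnj[OF LIMSEQ_qPoch_inf[OF assms, of b]] by simp
  show "(\<lambda>n. \<Prod>j<n. 1 - cnj b * cnj p ^ j) \<longlonglongrightarrow> qPoch_inf (cnj b) (cnj p)"
    by (rule LIMSEQ_qPoch_inf) (use assms in simp)
qed

lemma qPoch_inf_nonzero:
  assumes "cmod p < 1" "cmod b < 1"
  shows "qPoch_inf b p \<noteq> 0"
  unfolding qPoch_inf_def
proof (rule prodinf_nonzero[OF convergent_prod_qPoch[OF assms(1)]])
  fix j
  have "cmod (b * p ^ j) \<le> cmod b"
    using assms by (simp add: norm_mult norm_power mult_left_le power_le_one)
  with assms show "1 - b * p ^ j \<noteq> 0"
    by auto
qed

text \<open>The finite products are polynomials in b. On the unit disc around z they converge
  uniformly by the M-test, since |b| is at most |z| + 1 there.\<close>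

lemma holomorphic_qPoch_inf:
  assumes "cmod p < 1"
  shows "(\<lambda>b. qPoch_inf b p) holomorphic_on UNIV"
proof (rule holomorphic_uniform_sequence[where f = "\<lambda>n b. \<Prod>j<n. 1 - b * p ^ j"])
  fix z :: complex
  define R where "R = cmod z + 1"
  have le: "cmod (1 - b * p ^ j - 1) \<le> R * cmod p ^ j" if "b \<in> cball z 1" for b j
  proof -
    have "cmod b \<le> R"
      using that norm_triangle_ineq2[of b z] by (simp add: R_def dist_norm norm_minus_commute)
    then show ?thesis
      by (simp add: norm_mult norm_power mult_right_mono)
  qed
  have "summable (\<lambda>j. R * cmod p ^ j)"
    using assms by (intro summable_mult summable_geometric) simp
  then have "uniformly_convergent_on (cball z 1) (\<lambda>N b. \<Sum>j<N. cmod (1 - b * p ^ j - 1))"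
    by (rule Weierstrass_m_test'[rotated]) (use le in auto)
  then have "uniformly_convergent_on (cball z 1) (\<lambda>n b. \<Prod>j<n. 1 - b * p ^ j)"
    by (intro uniformly_convergent_on_prod' continuous_intros) auto
  then obtain l where l: "uniform_limit (cball z 1) (\<lambda>n b. \<Prod>j<n. 1 - b * p ^ j) l sequentially"
    by (auto simp: uniformly_convergent_on_def)
  have "l b = qPoch_inf b p" if "b \<in> cball z 1" for b
    using tendsto_uniform_limitI[OF l that] LIMSEQ_qPoch_inf[OF assms] LIMSEQ_unique by blast
  then have "uniform_limit (cball z 1) (\<lambda>n b. \<Prod>j<n. 1 - b * p ^ j) (\<lambda>b. qPoch_inf b p) sequentially"
    using l by (rule uniform_limit_cong'[OF refl, THEN iffD1])
  then show "\<exists>d>0. cball z d \<subseteq> UNIV \<and>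
      uniform_limit (cball z d) (\<lambda>n b. \<Prod>j<n. 1 - b * p ^ j) (\<lambda>b. qPoch_inf b p) sequentially"
    by (intro exI[of _ 1]) auto
next
  show "(\<lambda>b. \<Prod>j<n. 1 - b * p ^ j) holomorphic_on UNIV" for n
    by (intro holomorphic_intros)
qed simp

subsection \<open>Powers of q and products along an exponent\<close>

lemma qpow_add: "qpow \<tau> (u + v) = qpow \<tau> u * qpow \<tau> v"
  by (simp add: qpow_def distrib_left exp_add)

lemma qpow_minus: "qpow \<tau> (- u) = inverse (qpow \<tau> u)"
  by (simp add: qpow_def exp_minus)

lemma qpow_diff: "qpow \<tau> (u - v) = qpow \<tau> u / qpow \<tau> v"
  by (simp add: qpow_def right_diff_distrib exp_diff)

lemma qpow_nonzero [simp]: "qpow \<tau> u \<noteq> 0"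
  by (simp add: qpow_def)

lemma qpow_of_nat_mult: "qpow \<tau> (of_nat n * u) = qpow \<tau> u ^ n"
proof -
  have "2 * of_real pi * \<i> * \<tau> * (of_nat n * u) = of_nat n * (2 * of_real pi * \<i> * \<tau> * u)"
    by simp
  then show ?thesis
    unfolding qpow_def by (metis exp_of_nat_mult)
qed

lemma qpow_numeral_mult: "qpow \<tau> (numeral n * u) = qpow \<tau> u ^ numeral n"
  using qpow_of_nat_mult[of \<tau> "numeral n" u] by simp

lemma qpow_numeral: "qpow \<tau> (numeral n) = qpow \<tau> 1 ^ numeral n"
  using qpow_numeral_mult[of \<tau> n 1] by simp

lemma holomorphic_qpow [holomorphic_intros]:
  "f holomorphic_on S \<Longrightarrow> (\<lambda>z. qpow \<tau> (f z)) holomorphic_on S"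
  unfolding qpow_def by (intro holomorphic_intros)

lemma qpow_int_div_period:
  assumes "\<tau> \<noteq> 0"
  shows "qpow \<tau> (of_int n / \<tau>) = 1"
proof -
  have "2 * of_real pi * \<i> * \<tau> * (of_int n / \<tau>) = (2 * of_int n * pi) * \<i>"
    using assms by simp
  then show ?thesis
    unfolding qpow_def by (metis Ints_of_int exp_integer_2pi)
qed

locale imaginary_tau =
  fixes \<tau> :: complex
  assumes Re_tau: "Re \<tau> = 0" and Im_tau: "Im \<tau> > 0"
begin

lemma tau_nonzero [simp]: "\<tau> \<noteq> 0"
  using Im_tau by auto

lemma norm_qpow: "cmod (qpow \<tau> u) = exp (- (2 * pi * Im \<tau> * Re u))"
  by (simp add: qpow_def Re_tau)

lemma norm_qpow_less_1: "Re u > 0 \<Longrightarrow> cmod (qpow \<tau> u) < 1"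
  by (simp add: norm_qpow Im_tau)

lemma cnj_qpow: "cnj (qpow \<tau> u) = qpow \<tau> (cnj u)"
proof -
  have "cnj \<tau> = - \<tau>"
    by (simp add: complex_eq_iff Re_tau)
  then show ?thesis
    by (simp add: qpow_def exp_cnj)
qed

text \<open>Indexing the product by the exponent turns multiplication by the base into the
  translation u -> u + 2 and makes 1/\<tau> a period.\<close>

definition P :: "complex \<Rightarrow> complex" where
  "P u = qPoch_inf (qpow \<tau> u) ((qpow \<tau> 1)\<^sup>2)"

lemma norm_base: "cmod ((qpow \<tau> 1)\<^sup>2) < 1"
  using norm_qpow_less_1[of 1] by (simp add: norm_power abs_square_less_1)

lemma P_rec: "P u = (1 - qpow \<tau> u) * P (u + 2)"
  unfolding P_def qpow_add by (subst qPoch_inf_rec[OF norm_base]) (simp add: qpow_numeral)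

lemma P_step: "v = u + 2 \<Longrightarrow> P u = (1 - qpow \<tau> u) * P v"
  using P_rec[of u] by simp

lemma P_nonzero: "Re u > 0 \<Longrightarrow> P u \<noteq> 0"
  unfolding P_def by (intro qPoch_inf_nonzero norm_base norm_qpow_less_1)

lemma cnj_P: "cnj (P u) = P (cnj u)"
  unfolding P_def by (simp add: cnj_qPoch_inf[OF norm_base] cnj_qpow)

lemma P_period: "P (u + 1 / \<tau>) = P u"  "P (u - 1 / \<tau>) = P u"
  using qpow_int_div_period[of \<tau> 1] by (simp_all add: P_def qpow_add qpow_diff)

lemma holomorphic_P [holomorphic_intros]:
  assumes "f holomorphic_on S"
  shows "(\<lambda>z. P (f z)) holomorphic_on S"
proof -
  have "((\<lambda>b. qPoch_inf b ((qpow \<tau> 1)\<^sup>2)) \<circ> (\<lambda>z. qpow \<tau> (f z))) holomorphic_on S"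
    by (intro holomorphic_on_compose holomorphic_intros assms
              holomorphic_on_subset[OF holomorphic_qPoch_inf[OF norm_base]]) auto
  then show ?thesis
    by (simp add: P_def o_def)
qed

end

subsection \<open>Shifting the line of integration\<close>

lemma integral_periodic_line_shift:
  fixes H :: "complex \<Rightarrow> complex"
  assumes p: "Re p = 0" "p \<noteq> 0"
    and holo: "H holomorphic_on {z. a < Re z \<and> Re z < b}"
    and per: "\<And>z. a < Re z \<Longrightarrow> Re z < b \<Longrightarrow> H (z + p) = H z"
    and w: "a < Re w" "Re w < b" "a < Re w'" "Re w' < b"
  shows "integral {0..1::real} (\<lambda>y. H (w + of_real y * p)) = integral {0..1} (\<lambda>y. H (w' + of_real y * p))"
proof -
  define S where "S = {z. a < Re z \<and> Re z < b}"
  have "open S" "convex S"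
    unfolding S_def Collect_conj_eq
    by (auto intro!: open_Int convex_Int open_halfspace_Re_gt open_halfspace_Re_lt
          convex_halfspace_Re_gt convex_halfspace_Re_lt)
  have inS: "z + of_real y * p \<in> S" if "z \<in> S" for z and y :: real
    using that p by (simp add: S_def)
  have der: "(H has_field_derivative deriv H z) (at z)" if "z \<in> S" for z
    using holo \<open>open S\<close> that by (intro holomorphic_derivI[of H S]) (auto simp: S_def)
  have cont': "continuous_on S (deriv H)"
    using holo \<open>open S\<close> by (intro holomorphic_on_imp_continuous_on holomorphic_deriv) (auto simp: S_def)
  have cont: "continuous_on S H"
    using holo by (auto intro: holomorphic_on_imp_continuous_on simp: S_def)
  have "((\<lambda>z. integral (cbox 0 1) (\<lambda>y. H (z + of_real y * p))) has_field_derivative 0) (at z within S)"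
    if z: "z \<in> S" for z
  proof -
    have "((\<lambda>z. integral (cbox 0 1) (\<lambda>y. H (z + of_real y * p))) has_field_derivative
        integral (cbox 0 1) (\<lambda>y::real. deriv H (z + of_real y * p))) (at z within S)"
    proof (rule leibniz_rule_field_derivative[OF _ _ _ z \<open>convex S\<close>])
      show "((\<lambda>z. H (z + of_real y * p)) has_field_derivative deriv H (z + of_real y * p)) (at z within S)"
        if "z \<in> S" for z and y :: real
      proof -
        have "((\<lambda>z. z + of_real y * p) has_field_derivative 1) (at z within S)"
          by (auto intro!: derivative_eq_intros)
        from DERIV_chain2[where f = H, OF der[OF inS[OF that]] this] show ?thesis
          by simp
      qed
      show "(\<lambda>y::real. H (z + of_real y * p)) integrable_on cbox 0 1" if "z \<in> S" for z
        by (intro integrable_continuous continuous_on_compose2[OF cont] continuous_intros)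
           (use inS that in auto)
      show "continuous_on (S \<times> cbox 0 1) (\<lambda>(z, y::real). deriv H (z + of_real y * p))"
        unfolding split_beta
        by (intro continuous_on_compose2[OF cont'] continuous_intros) (use inS in auto)
    qed
    moreover have "((\<lambda>y::real. deriv H (z + of_real y * p)) has_integral
        (H (z + of_real 1 * p) / p - H (z + of_real 0 * p) / p)) {0..1}"
    proof (rule fundamental_theorem_of_calculus)
      fix y :: real
      have "((\<lambda>y. z + of_real y * p) has_vector_derivative p) (at y within {0..1})"
        by (auto intro!: derivative_eq_intros)
      from field_vector_diff_chain_within[OF this, of H] der[OF inS[OF z, of y]]
      have "((\<lambda>y. H (z + of_real y * p)) has_vector_derivative p * deriv H (z + of_real y * p))
          (at y within {0..1})"
        by (auto simp: o_def intro: has_field_derivative_at_within)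
      from has_vector_derivative_divide[OF this, of p]
      show "((\<lambda>y. H (z + of_real y * p) / p) has_vector_derivative deriv H (z + of_real y * p))
          (at y within {0..1})"
        using p by simp
    qed simp
    moreover have "H (z + p) = H z"
      using per z by (simp add: S_def)
    ultimately show ?thesis
      by (simp add: integral_unique)
  qed
  from has_field_derivative_zero_constant[OF \<open>convex S\<close> this]
  obtain c where c: "\<forall>z\<in>S. integral (cbox 0 1) (\<lambda>y::real. H (z + of_real y * p)) = c"
    by blast
  have "w \<in> S" "w' \<in> S"
    using w by (simp_all add: S_def)
  with c have "integral (cbox 0 1) (\<lambda>y::real. H (w + of_real y * p)) =
      integral (cbox 0 1) (\<lambda>y. H (w' + of_real y * p))"
    by metis
  then show ?thesis
    by simp
qed


subsection \<open>The telescoping identity\<close>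

text \<open>
  Gosper's algorithm makes the quotient of \<open>H\<close> by a product of q-shifted factorials a Laurent
  polynomial in \<open>q\<^sup>z\<close>. Its degrees are at most 1 in absolute value, since only there the leading
  terms of \<open>H (z + 2)\<close> and \<open>H z\<close> cancel. Solving for the three coefficients gives the
  certificate below, where \<open>M = q\<^bsup>2i\<lambda>\<^esup>\<close> and \<open>v = q\<^bsup>i\<lambda>+x+z\<^esup>\<close>, while \<open>q\<^sup>\<rho>\<close> and \<open>q\<^bsup>\<alpha>+\<rho>\<^esup>\<close> enter only
  through their sums \<open>R\<close> and \<open>T\<close> with their inverses. It is arranged along two
  quadratic factors, of which, for \<open>u = 1 + x + z\<close>, the first divides both \<open>F u\<close> and \<open>F (u + 2)\<close>
  and the second divides \<open>F (u - 2)\<close> relative to the common part \<open>W u\<close> of the three; the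
  telescoping identity then splits into three smaller ones.
\<close>

definition certificate ::
  "complex \<Rightarrow> complex \<Rightarrow> complex \<Rightarrow> complex \<Rightarrow> complex \<Rightarrow> complex \<Rightarrow> complex \<Rightarrow> complex \<Rightarrow> complex" where
  "certificate q X M b s R T v =
     q * X / (1 - X^2) * (q * X / (1 - q^2 * X^2) * (R - q * X * (s + 1 / s)) - 1 / v) / b
       * ((1 - q * b * s * M / v) * (1 - b * s * v / (q * M)))
     + q * X / (1 - X^2) * (X / (X^2 - q^2) * (q * T - X * (b * s + 1 / (b * s))) + q * M / v)
       * ((1 - s * v) * (1 - s / v))"

context
  fixes q X M b s v n1 n2 n3 :: complex
  assumes nz: "q \<noteq> 0" "X \<noteq> 0" "M \<noteq> 0" "b \<noteq> 0" "s \<noteq> 0" "v \<noteq> 0" "n1 \<noteq> 0" "n2 \<noteq> 0" "n3 \<noteq> 0"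
    and n: "n1 = 1 - X^2" "n2 = 1 - q^2 * X^2" "n3 = X^2 - q^2"
begin

text \<open>The product of the first two factors on the right divides both F u and F (u - 2). Modulo
  it only the B-term of the telescoping identity survives, and the cofactor found here reappears in
  \<open>certificate_identity_C\<close>.\<close>

lemma certificate_identity_B:
  "(n2 - q * s * X * Y) * (n2 - q * X * Y / s) / (n1 * n2) / b
     - (Y + q * X * (s + 1 / s) - q * v / X - X / (q * v)) * (q * X / n1 * (q * X / n2 * Y - 1 / (q^2 * v)) / b)
    = (1 - q^2 * s * v) * (1 - s / (q^2 * v)) * (X^2 / (b * s * n1 * v) - q * X / (s * b * n1 * n2) * Y)"
  \<comment> \<open>The denominators are variables, so clearing fractions does not expand them;
    their defining equations enter only as relations in the final ideal-membership problem.\<close>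
  using nz by (simp add: divide_simps, use n in algebra)

text \<open>The counterpart modulo the quadratic factor shared by F u and F (u + 2), where only the
  D-term survives. Later \<open>S\<close> is \<open>b * s\<close>.\<close>

lemma certificate_identity_D:
  assumes "S \<noteq> 0"
  shows "- ((X * Z + S * n3) * (X * Z + n3 / S) / (n1 * n3))
     + ((Z + X * (S + 1 / S)) / q - v / (M * X) - M * X / v) * (q * X / n1 * (X / n3 * Z + q * M / v))
    = (1 - q * S * M / v) * (1 - S * v / (q * M)) * (q * M * X^2 / (S * n1 * v) + q^2 * X / (S * n1 * n3) * Z)"
  using nz assms by (simp add: divide_simps, use n in algebra)

text \<open>Once the B- and D-identities are substituted, both quadratic factors cancel from the
  telescoping identity. This is the remainder, and the only one of the three identities in which the
  eigenvalue occurs.\<close>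

lemma certificate_identity_C:
  "(1 - b * s * M / (q * v)) * (1 - b * s * q * v / M) * (X^2 / (b * s * n1 * v) - q * X / (s * b * n1 * n2) * Y) / b
     - (n2 - q * s * X * Y) * (1 - X * Z / (b * s) - X^2 * (1 + 1 / (b * s)^2) + q^2 * X^2 / (b * s)^2) / (n1 * n2)
     - (1 - q * s * Y / X - q^2 * (s^2 + 1) + q^2 * s^2 / X^2) * (X^2 * (X * Z + n3 / (b * s)) / (b * s * n1 * n3))
     - (q / b * (M + 1 / M) - 1 - q^2 / b^2)
     - (Y + q * X * (s + 1 / s) - q * v / X - X / (q * v)) * (q * X / n1 * (X / n3 * Z + q * M / (q^2 * v))) / b
     + ((Z + X * (b * s + 1 / (b * s))) / q - v / (M * X) - M * X / v) * (q * X / n1 * (q * X / n2 * Y - 1 / v) / b)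
     + (1 - s * v) * (1 - s / v) * (q * M * X^2 / (b * s * n1 * v) + q^2 * X / (b * s * n1 * n3) * Z) = 0"
  using nz by (simp add: divide_simps, use n in algebra)

end

text \<open>In the notation of the proof, where a prime on h, k, a, c means v -> q^2 v, the left
  side is B/b h h' + (-A - A' - E) h k' + D b k k' and the certificate is a h + c k. Reduction
  modulo k' and modulo h gives \<open>idB\<close> and \<open>idD\<close>; dividing the rest by h k'
  gives \<open>idC\<close>.\<close>

lemma certificate_identity:
  fixes q X M b s R T v :: complex
  assumes nz: "q \<noteq> 0" "X \<noteq> 0" "M \<noteq> 0" "b \<noteq> 0" "s \<noteq> 0" "v \<noteq> 0"
    and gen: "1 - X^2 \<noteq> 0" "1 - q^2 * X^2 \<noteq> 0" "X^2 - q^2 \<noteq> 0"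
    and B: "B = (1 - q * s * X * R + q^2 * s^2 * X^2) * (1 - q * X * R / s + q^2 * X^2 / s^2)
                / ((1 - X^2) * (1 - q^2 * X^2)) / b"
    and A: "A = (1 - q * s * X * R + q^2 * s^2 * X^2) * (1 - q * X / (b * s) * T + q^2 * X^2 / (b * s)^2)
                / ((1 - X^2) * (1 - q^2 * X^2))"
    and A': "A' = (1 - q * s / X * R + q^2 * s^2 / X^2) * (1 - q / X / (b * s) * T + q^2 / X^2 / (b * s)^2)
                / ((1 - 1 / X^2) * (1 - q^2 / X^2))"
    and D: "D = (1 - q * b * s * T / X + q^2 * (b * s)^2 / X^2) * (1 - q * T / (b * s) / X + q^2 / (b * s)^2 / X^2)
                / ((1 - 1 / X^2) * (1 - q^2 / X^2)) / b"
    and E: "E = q / b * (M + 1 / M) - 1 - q^2 / b^2"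
  shows "B / b * (1 - q * b * s * M / v) * (1 - b * s * M / (q * v)) * (1 - b * s * v / (q * M)) * (1 - b * s * q * v / M)
     + (- A - A' - E) * (1 - q * b * s * M / v) * (1 - q^2 * s * v) * (1 - b * s * v / (q * M)) * (1 - s / (q^2 * v))
     + D * b * (1 - q^2 * s * v) * (1 - s * v) * (1 - s / (q^2 * v)) * (1 - s / v)
   = certificate q X M b s R T (q^2 * v) * (R - q * v / X - X / (q * v)) / b
       * (1 - q * b * s * M / v) * (1 - b * s * v / (q * M))
     - certificate q X M b s R T v * (T - v / (M * X) - M * X / v) * (1 - q^2 * s * v) * (1 - s / (q^2 * v))"
proof -
  define S where "S = b * s"
  \<comment> \<open>\<open>Y\<close> and \<open>Z\<close> are R and q T shifted so that the
    quadratic factors of the coefficients split off the denominators, as in 1 - q s X R + q^2 s^2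
    X^2 = n2 - q s X Y.\<close>
  define Y where "Y = R - q * X * (s + 1 / s)"
  define Z where "Z = q * T - X * (S + 1 / S)"
  define n1 where "n1 = 1 - X^2"
  define n2 where "n2 = 1 - q^2 * X^2"
  define n3 where "n3 = X^2 - q^2"
  \<comment> \<open>Not the parameters of the same names: \<open>\<rho>\<close> and
    \<open>\<tau>\<close> here are the multipliers of the reflected F in H (z + 2) and in H
    z.\<close>
  define \<rho> where "\<rho> = R - q * v / X - X / (q * v)"
  define \<tau> where "\<tau> = T - v / (M * X) - M * X / v"
  define h where "h = (1 - q * S * M / v) * (1 - S * v / (q * M))"
  define h' where "h' = (1 - S * M / (q * v)) * (1 - S * q * v / M)"
  define k where "k = (1 - s * v) * (1 - s / v)"
  define k' where "k' = (1 - q^2 * s * v) * (1 - s / (q^2 * v))"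
  define a where "a = q * X / n1 * (q * X / n2 * Y - 1 / v) / b"
  define a' where "a' = q * X / n1 * (q * X / n2 * Y - 1 / (q^2 * v)) / b"
  define c where "c = q * X / n1 * (X / n3 * Z + q * M / v)"
  define c' where "c' = q * X / n1 * (X / n3 * Z + q * M / (q^2 * v))"
  define e where "e = X^2 / (S * n1 * v) - q * X / (s * b * n1 * n2) * Y"
  define f where "f = q * M * X^2 / (S * n1 * v) + q^2 * X / (S * n1 * n3) * Z"
  have S: "S \<noteq> 0" and n0: "n1 \<noteq> 0" "n2 \<noteq> 0" "n3 \<noteq> 0"
    using nz gen by (auto simp: S_def n1_def n2_def n3_def)
  have R: "R = Y + q * X * (s + 1 / s)" and T: "T = (Z + X * (S + 1 / S)) / q"
    using nz by (simp_all add: Y_def Z_def)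
  note n = n1_def n2_def n3_def
  have B': "B = (n2 - q * s * X * Y) * (n2 - q * X * Y / s) / (n1 * n2) / b"
  proof -
    have *: "1 - q * s * X * R + q^2 * s^2 * X^2 = n2 - q * s * X * Y"
      "1 - q * X * R / s + q^2 * X^2 / s^2 = n2 - q * X * Y / s"
      using nz by (simp_all add: Y_def n2_def field_simps power2_eq_square)
    show ?thesis
      unfolding B * n by (rule refl)
  qed
  have A1: "A = (n2 - q * s * X * Y) * (1 - X * Z / S - X^2 * (1 + 1 / S^2) + q^2 * X^2 / S^2) / (n1 * n2)"
  proof -
    have *: "1 - q * s * X * R + q^2 * s^2 * X^2 = n2 - q * s * X * Y"
      using nz by (simp add: Y_def n2_def field_simps power2_eq_square)
    have **: "1 - q * X / S * T + q^2 * X^2 / S^2 = 1 - X * Z / S - X^2 * (1 + 1 / S^2) + q^2 * X^2 / S^2"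
      using nz S by (simp add: Z_def field_simps power2_eq_square)
    show ?thesis
      unfolding A S_def[symmetric] * ** unfolding n by (rule refl)
  qed
  have den: "(1 - 1 / X^2) * (1 - q^2 / X^2) = - (n1 * n3) / X^4"
    using nz by (simp add: n field_simps power2_eq_square power4_eq_xxxx)
  have T1: "1 - q / X / S * T + q^2 / X^2 / S^2 = - ((X * Z + n3 / S) / (S * X^2))"
    using nz S by (simp add: Z_def n3_def field_simps power2_eq_square)
  have A2: "A' = (1 - q * s * Y / X - q^2 * (s^2 + 1) + q^2 * s^2 / X^2) * (X^2 * (X * Z + n3 / S) / (S * n1 * n3))"
  proof -
    have "1 - q * s / X * R + q^2 * s^2 / X^2 = 1 - q * s * Y / X - q^2 * (s^2 + 1) + q^2 * s^2 / X^2"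
      using nz by (simp add: Y_def field_simps power2_eq_square)
    then have "A' = (1 - q * s * Y / X - q^2 * (s^2 + 1) + q^2 * s^2 / X^2) *
        (- ((X * Z + n3 / S) / (S * X^2)) / (- (n1 * n3) / X^4))"
      unfolding A' den S_def[symmetric] T1 by simp
    also have "- ((X * Z + n3 / S) / (S * X^2)) / (- (n1 * n3) / X^4) = X^2 * (X * Z + n3 / S) / (S * n1 * n3)"
      using nz S n0 by (simp add: divide_simps power2_eq_square power4_eq_xxxx)
    finally show ?thesis .
  qed
  have D': "D * b = - ((X * Z + S * n3) * (X * Z + n3 / S) / (n1 * n3))"
  proof -
    have "1 - q * S * T / X + q^2 * S^2 / X^2 = - (S * (X * Z + S * n3) / X^2)"
      using nz S by (simp add: Z_def n3_def field_simps power2_eq_square)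
    moreover have "1 - q * T / S / X + q^2 / S^2 / X^2 = - ((X * Z + n3 / S) / (S * X^2))"
      unfolding T1[symmetric] by (simp add: mult_ac)
    ultimately have "D * b = - (S * (X * Z + S * n3) / X^2) * - ((X * Z + n3 / S) / (S * X^2)) / (- (n1 * n3) / X^4)"
      unfolding D den using nz by (simp add: S_def mult_ac)
    also have "\<dots> = - ((X * Z + S * n3) * (X * Z + n3 / S) / (n1 * n3))"
      using nz S n0 by (simp add: divide_simps power2_eq_square power4_eq_xxxx)
    finally show ?thesis .
  qed
  have idB: "B = \<rho> * a' + k' * e"
    using certificate_identity_B[OF nz n0 n, of Y]
    unfolding B' \<rho>_def a'_def k'_def e_def R S_def by (simp add: algebra_simps)
  have idD: "D * b = - \<tau> * c + h * f"
    using certificate_identity_D[OF nz n0 n S, of Z]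
    unfolding D' \<tau>_def c_def h_def f_def T by (simp add: algebra_simps)
  have "h' * e / b - A - A' - E - \<rho> * c' / b + \<tau> * a + k * f = 0"
    using certificate_identity_C[OF nz n0 n, of Y Z, folded S_def]
    unfolding A1 A2 E \<rho>_def \<tau>_def a_def c'_def h'_def k_def e_def f_def R T S_def[symmetric] .
  then have idC: "- A - A' - E = \<rho> * c' / b - \<tau> * a - k * f - h' * e / b"
    by (simp add: algebra_simps)
  have cert: "certificate q X M b s R T v = a * h + c * k"
    unfolding certificate_def a_def c_def h_def k_def Y_def Z_def n S_def by (simp only: mult.assoc)
  have "(1 - q * b * s * M / (q^2 * v)) * (1 - b * s * (q^2 * v) / (q * M)) = h'"
    "(1 - s * (q^2 * v)) * (1 - s / (q^2 * v)) = k'"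
    using nz by (simp_all add: h'_def k'_def S_def power2_eq_square mult_ac)
  then have cert': "certificate q X M b s R T (q^2 * v) = a' * h' + c' * k'"
    unfolding certificate_def a'_def c'_def Y_def Z_def n S_def by (simp only: mult.assoc)
  have "B / b * h * h' + (- A - A' - E) * h * k' + D * b * k * k'
      = certificate q X M b s R T (q^2 * v) * \<rho> / b * h - certificate q X M b s R T v * \<tau> * k'"
    unfolding idB idC idD cert cert' by (simp add: divide_inverse algebra_simps)
  then show ?thesis
    unfolding h_def h'_def k_def k'_def \<rho>_def \<tau>_def S_def by (simp only: mult_ac)
qed

lemma holomorphic_certificate:
  assumes "f holomorphic_on S" "\<And>z. z \<in> S \<Longrightarrow> f z \<noteq> 0"
    and "q \<noteq> 0" "M \<noteq> 0" "b \<noteq> 0" "s \<noteq> 0" "1 - X^2 \<noteq> 0" "1 - q^2 * X^2 \<noteq> 0" "X^2 - q^2 \<noteq> 0"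
  shows "(\<lambda>z. certificate q X M b s R T (f z)) holomorphic_on S"
  unfolding certificate_def by (intro holomorphic_intros assms(1)) (use assms(2-) in auto)

section \<open>Reduction of f to periodic quotients of q-shifted factorials\<close>

context imaginary_tau
begin

definition F :: "complex \<Rightarrow> complex \<Rightarrow> complex \<Rightarrow> complex \<Rightarrow> complex" where
  "F \<alpha> \<rho> lam z = qpow \<tau> (- (\<alpha> * z / 2)) *
     (P (2 + \<alpha> + \<rho> + \<i> * lam - z) * P (1 + \<rho> + \<i> * lam + z)) /
     (P (\<alpha> + \<rho> - \<i> * lam + z) * P (1 + \<rho> - \<i> * lam - z))"

text \<open>Since q^(1/(2 \<tau>)) = -1, the shift by 1/(2 \<tau>) removes the minus sign in the
  product.\<close>

lemma Gamma_2tau_eq: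
  "Gamma_2tau \<tau> (u - 1 / (2 * \<tau>)) = qpow \<tau> (- ((u - 1 / (2 * \<tau>))\<^sup>2) / 8) / P (u + 1)"
proof -
  have "2 * of_real pi * \<i> * \<tau> * (1 / (2 * \<tau>)) = of_real pi * \<i>"
    by simp
  then have "qpow \<tau> (1 / (2 * \<tau>)) = - 1"
    unfolding qpow_def by simp
  then have "- qpow \<tau> (u - 1 / (2 * \<tau>) + 1) = qpow \<tau> (u + 1)"
    unfolding qpow_add qpow_diff by simp
  then show ?thesis
    by (simp add: Gamma_2tau_def P_def)
qed

text \<open>Two squares enter with each sign, so the terms in z^2 cancel and the linear ones add up
  to -\<alpha> z/2. With division by zero giving 0 on both sides, the equation holds at the poles
  too.\<close>

lemma f_fun_eq:
  obtains K where "\<And>z. f_fun \<tau> lam z \<alpha> \<rho> = K * F \<alpha> \<rho> lam z"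
proof
  fix z
  define h where "h = 1 / (2 * \<tau>)"
  define K where "K = - ((- 1 + \<alpha> + \<rho> - \<i> * lam - h)\<^sup>2 + (\<rho> - \<i> * lam - h)\<^sup>2
      - (1 + \<alpha> + \<rho> + \<i> * lam - h)\<^sup>2 - (\<rho> + \<i> * lam - h)\<^sup>2) / 8"
  define u1 where "u1 = - 1 + \<alpha> + \<rho> - \<i> * lam + z"
  define u2 where "u2 = \<rho> - \<i> * lam - z"
  define u3 where "u3 = 1 + \<alpha> + \<rho> + \<i> * lam - z"
  define u4 where "u4 = \<rho> + \<i> * lam + z"
  note G = Gamma_2tau_eq[folded h_def]
  have "f_fun \<tau> lam z \<alpha> \<rho> =
      Gamma_2tau \<tau> (u1 - h) * Gamma_2tau \<tau> (u2 - h) / (Gamma_2tau \<tau> (u3 - h) * Gamma_2tau \<tau> (u4 - h))"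
    unfolding f_fun_def u1_def u2_def u3_def u4_def h_def by (simp add: algebra_simps)
  also have "\<dots> = qpow \<tau> (- ((u1 - h)\<^sup>2) / 8 + - ((u2 - h)\<^sup>2) / 8 - (- ((u3 - h)\<^sup>2) / 8 + - ((u4 - h)\<^sup>2) / 8))
      * (P (u3 + 1) * P (u4 + 1)) / (P (u1 + 1) * P (u2 + 1))"
    unfolding G qpow_add qpow_diff by simp
  also have "- ((u1 - h)\<^sup>2) / 8 + - ((u2 - h)\<^sup>2) / 8 - (- ((u3 - h)\<^sup>2) / 8 + - ((u4 - h)\<^sup>2) / 8)
      = K + - (\<alpha> * z / 2)"
    unfolding K_def u1_def u2_def u3_def u4_def by (simp add: power2_eq_square field_simps)
  finally have eq: "f_fun \<tau> lam z \<alpha> \<rho> = qpow \<tau> (K + - (\<alpha> * z / 2)) *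
      (P (u3 + 1) * P (u4 + 1)) / (P (u1 + 1) * P (u2 + 1))" .
  have u: "u3 + 1 = 2 + \<alpha> + \<rho> + \<i> * lam - z" "u4 + 1 = 1 + \<rho> + \<i> * lam + z"
      "u1 + 1 = \<alpha> + \<rho> - \<i> * lam + z" "u2 + 1 = 1 + \<rho> - \<i> * lam - z"
    by (simp_all add: u1_def u2_def u3_def u4_def)
  show "f_fun \<tau> lam z \<alpha> \<rho> = qpow \<tau> (- ((- 1 + \<alpha> + \<rho> - \<i> * lam - 1 / (2 * \<tau>))\<^sup>2
      + (\<rho> - \<i> * lam - 1 / (2 * \<tau>))\<^sup>2 - (1 + \<alpha> + \<rho> + \<i> * lam - 1 / (2 * \<tau>))\<^sup>2
      - (\<rho> + \<i> * lam - 1 / (2 * \<tau>))\<^sup>2) / 8) * F \<alpha> \<rho> lam z"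
    unfolding eq u qpow_add by (simp add: F_def K_def h_def)
qed

lemma cnj_F:
  assumes "cnj \<alpha> = \<alpha>" "cnj \<rho> = \<rho>" "cnj lam = lam"
  shows "cnj (F \<alpha> \<rho> lam z) = F \<alpha> \<rho> (- lam) (cnj z)"
  using assms by (simp add: F_def cnj_P cnj_qpow)

lemma qpow_half_period:
  assumes "even \<alpha>"
  shows "qpow \<tau> (- (of_int \<alpha> * (z + 1 / \<tau>) / 2)) = qpow \<tau> (- (of_int \<alpha> * z / 2))"
proof -
  obtain k where k: "\<alpha> = 2 * k"
    using assms by auto
  have "- (of_int \<alpha> * (z + 1 / \<tau>) / 2) = - (of_int \<alpha> * z / 2) - of_int k / \<tau>"
    by (simp add: k field_simps)
  then show ?thesis
    by (simp only: qpow_diff qpow_int_div_period[OF tau_nonzero] div_by_1)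
qed

lemma F_period:
  assumes "even \<alpha>"
  shows "F (of_int \<alpha>) \<rho> lam (z + 1 / \<tau>) = F (of_int \<alpha>) \<rho> lam z"
proof -
  have s: "u - (z + 1 / \<tau>) = u - z - 1 / \<tau>" "u + (z + 1 / \<tau>) = u + z + 1 / \<tau>" for u
    by simp_all
  show ?thesis
    unfolding F_def qpow_half_period[OF assms] s P_period ..
qed

lemma holomorphic_F:
  assumes "Im lam = 0"
  shows "F \<alpha> \<rho> lam holomorphic_on {z. - Re (\<alpha> + \<rho>) < Re z \<and> Re z < 1 + Re \<rho>}"
  unfolding F_def by (intro holomorphic_intros) (use assms in \<open>auto intro!: P_nonzero\<close>)

section \<open>Shift relations of the two factors of the integrand\<close>

text \<open>
  \<open>W\<close> is the common part of \<open>F\<close> at the arguments \<open>u - 2\<close>, \<open>u\<close> and \<open>u + 2\<close>, and \<open>V\<close> the common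
  part at \<open>u - 2\<close> and \<open>u\<close>.
\<close>

definition W :: "complex \<Rightarrow> complex \<Rightarrow> complex \<Rightarrow> complex \<Rightarrow> complex" where
  "W \<beta> \<sigma> lam u = qpow \<tau> (- (\<beta> * u / 2)) *
     (P (4 + \<beta> + \<sigma> + \<i> * lam - u) * P (3 + \<sigma> + \<i> * lam + u)) /
     (P (\<beta> + \<sigma> - 2 - \<i> * lam + u) * P (\<sigma> - 1 - \<i> * lam - u))"

definition V :: "complex \<Rightarrow> complex \<Rightarrow> complex \<Rightarrow> complex \<Rightarrow> complex" where
  "V \<beta> \<sigma> lam u = qpow \<tau> (- (\<beta> * u / 2)) *
     (P (4 + \<beta> + \<sigma> + \<i> * lam - u) * P (1 + \<sigma> + \<i> * lam + u)) /
     (P (\<beta> + \<sigma> - 2 - \<i> * lam + u) * P (1 + \<sigma> - \<i> * lam - u))"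

lemma V_period:
  assumes "even \<beta>"
  shows "V (of_int \<beta>) \<sigma> lam (z + 1 / \<tau>) = V (of_int \<beta>) \<sigma> lam z"
proof -
  have s: "u - (z + 1 / \<tau>) = u - z - 1 / \<tau>" "u + (z + 1 / \<tau>) = u + z + 1 / \<tau>" for u
    by simp_all
  show ?thesis
    unfolding V_def qpow_half_period[OF assms] s P_period ..
qed

lemma holomorphic_V:
  assumes "Im lam = 0"
  shows "V \<beta> \<sigma> lam holomorphic_on {z. 2 - Re (\<beta> + \<sigma>) < Re z \<and> Re z < 1 + Re \<sigma>}"
  unfolding V_def by (intro holomorphic_intros) (use assms in \<open>auto intro!: P_nonzero\<close>)

text \<open>Steps of 2 express every \<open>P\<close> through one of four values \<open>p1\<close>
  to \<open>p4\<close>. Non-vanishing is required only of the denominators of \<open>W\<close>,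
  because by the recurrence all other denominators divide them.\<close>

lemma common_factors:
  assumes "P (\<beta> + \<sigma> - 2 - \<i> * lam + u) \<noteq> 0" "P (\<sigma> - 1 - \<i> * lam - u) \<noteq> 0"
  shows "F \<beta> \<sigma> lam u = W \<beta> \<sigma> lam u *
      ((1 - qpow \<tau> (2 + \<beta> + \<sigma> + \<i> * lam - u)) * (1 - qpow \<tau> (1 + \<sigma> + \<i> * lam + u)) *
       (1 - qpow \<tau> (\<beta> + \<sigma> - 2 - \<i> * lam + u)) * (1 - qpow \<tau> (\<sigma> - 1 - \<i> * lam - u)))" (is ?t0)
    and "F \<beta> \<sigma> lam (u + 2) = W \<beta> \<sigma> lam u * (qpow \<tau> (- \<beta>) *
      ((1 - qpow \<tau> (2 + \<beta> + \<sigma> + \<i> * lam - u)) * (1 - qpow \<tau> (\<beta> + \<sigma> + \<i> * lam - u)) *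
       (1 - qpow \<tau> (\<beta> + \<sigma> - 2 - \<i> * lam + u)) * (1 - qpow \<tau> (\<beta> + \<sigma> - \<i> * lam + u))))" (is ?t1)
    and "F \<beta> \<sigma> lam (u - 2) = W \<beta> \<sigma> lam u * (qpow \<tau> \<beta> *
      ((1 - qpow \<tau> (1 + \<sigma> + \<i> * lam + u)) * (1 - qpow \<tau> (\<sigma> - 1 + \<i> * lam + u)) *
       (1 - qpow \<tau> (\<sigma> - 1 - \<i> * lam - u)) * (1 - qpow \<tau> (\<sigma> + 1 - \<i> * lam - u))))" (is ?t2)
    and "V \<beta> \<sigma> lam u = W \<beta> \<sigma> lam u *
      ((1 - qpow \<tau> (1 + \<sigma> + \<i> * lam + u)) * (1 - qpow \<tau> (\<sigma> - 1 - \<i> * lam - u)))" (is ?t3)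
    and "V \<beta> \<sigma> lam (u + 2) = W \<beta> \<sigma> lam u * (qpow \<tau> (- \<beta>) *
      ((1 - qpow \<tau> (2 + \<beta> + \<sigma> + \<i> * lam - u)) * (1 - qpow \<tau> (\<beta> + \<sigma> - 2 - \<i> * lam + u))))" (is ?t4)
proof -
  define p1 where "p1 = P (4 + \<beta> + \<sigma> + \<i> * lam - u)"
  define p2 where "p2 = P (3 + \<sigma> + \<i> * lam + u)"
  define p3 where "p3 = P (2 + \<beta> + \<sigma> - \<i> * lam + u)"
  define p4 where "p4 = P (3 + \<sigma> - \<i> * lam - u)"
  have a1: "P (2 + \<beta> + \<sigma> + \<i> * lam - u) = (1 - qpow \<tau> (2 + \<beta> + \<sigma> + \<i> * lam - u)) * p1"
    unfolding p1_def by (rule P_step) simp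
  have a2: "P (\<beta> + \<sigma> + \<i> * lam - u) = (1 - qpow \<tau> (\<beta> + \<sigma> + \<i> * lam - u)) *
      ((1 - qpow \<tau> (2 + \<beta> + \<sigma> + \<i> * lam - u)) * p1)"
    unfolding a1[symmetric] by (rule P_step) simp
  have b1: "P (1 + \<sigma> + \<i> * lam + u) = (1 - qpow \<tau> (1 + \<sigma> + \<i> * lam + u)) * p2"
    unfolding p2_def by (rule P_step) simp
  have b2: "P (\<sigma> - 1 + \<i> * lam + u) = (1 - qpow \<tau> (\<sigma> - 1 + \<i> * lam + u)) *
      ((1 - qpow \<tau> (1 + \<sigma> + \<i> * lam + u)) * p2)"
    unfolding b1[symmetric] by (rule P_step) simp
  have c1: "P (\<beta> + \<sigma> - \<i> * lam + u) = (1 - qpow \<tau> (\<beta> + \<sigma> - \<i> * lam + u)) * p3"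
    unfolding p3_def by (rule P_step) simp
  have c2: "P (\<beta> + \<sigma> - 2 - \<i> * lam + u) = (1 - qpow \<tau> (\<beta> + \<sigma> - 2 - \<i> * lam + u)) *
      ((1 - qpow \<tau> (\<beta> + \<sigma> - \<i> * lam + u)) * p3)"
    unfolding c1[symmetric] by (rule P_step) simp
  have d1: "P (1 + \<sigma> - \<i> * lam - u) = (1 - qpow \<tau> (\<sigma> + 1 - \<i> * lam - u)) * p4"
    using P_step[of "3 + \<sigma> - \<i> * lam - u" "1 + \<sigma> - \<i> * lam - u"]
    by (simp add: p4_def add.commute)
  have d2: "P (\<sigma> - 1 - \<i> * lam - u) = (1 - qpow \<tau> (\<sigma> - 1 - \<i> * lam - u)) *
      ((1 - qpow \<tau> (\<sigma> + 1 - \<i> * lam - u)) * p4)"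
    unfolding d1[symmetric] by (rule P_step) simp
  note nz = assms[unfolded c2 d2 mult_eq_0_iff de_Morgan_disj]
  have q: "qpow \<tau> (- (\<beta> * (u + 2) / 2)) = qpow \<tau> (- (\<beta> * u / 2)) * qpow \<tau> (- \<beta>)"
    "qpow \<tau> (- (\<beta> * (u - 2) / 2)) = qpow \<tau> (- (\<beta> * u / 2)) * qpow \<tau> \<beta>"
    by (simp_all add: qpow_add[symmetric] algebra_simps add_divide_distrib diff_divide_distrib)
  have s: "2 + \<beta> + \<sigma> + \<i> * lam - (u + 2) = \<beta> + \<sigma> + \<i> * lam - u"
    "1 + \<sigma> + \<i> * lam + (u + 2) = 3 + \<sigma> + \<i> * lam + u"
    "\<beta> + \<sigma> - \<i> * lam + (u + 2) = 2 + \<beta> + \<sigma> - \<i> * lam + u"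
    "1 + \<sigma> - \<i> * lam - (u + 2) = \<sigma> - 1 - \<i> * lam - u"
    "2 + \<beta> + \<sigma> + \<i> * lam - (u - 2) = 4 + \<beta> + \<sigma> + \<i> * lam - u"
    "1 + \<sigma> + \<i> * lam + (u - 2) = \<sigma> - 1 + \<i> * lam + u"
    "\<beta> + \<sigma> - \<i> * lam + (u - 2) = \<beta> + \<sigma> - 2 - \<i> * lam + u"
    "1 + \<sigma> - \<i> * lam - (u - 2) = 3 + \<sigma> - \<i> * lam - u"
    "4 + \<beta> + \<sigma> + \<i> * lam - (u + 2) = 2 + \<beta> + \<sigma> + \<i> * lam - u"
    "\<beta> + \<sigma> - 2 - \<i> * lam + (u + 2) = \<beta> + \<sigma> - \<i> * lam + u"
    by simp_all
  show ?t0 ?t1 ?t2 ?t3 ?t4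
    unfolding F_def V_def W_def s q p1_def[symmetric] p2_def[symmetric] p3_def[symmetric]
      p4_def[symmetric] a1 a2 b1 b2 c1 c2 d1 d2
    using nz by (simp_all add: mult_ac)
qed

text \<open>The quotient of the reflected F at z + 2 and at z consists of linear factors in pairs,
  and (1 - c y) (1 - c/y) = c (c + 1/c - y - 1/y). This is the origin of the sums of a power and its
  inverse.\<close>

lemma F_reflected_shift:
  assumes "P (\<alpha> + \<rho> + \<i> * lam - z - 2) \<noteq> 0" "P (1 + \<rho> + \<i> * lam + z) \<noteq> 0"
  defines "T \<equiv> qpow \<tau> (\<alpha> + \<rho>) + 1 / qpow \<tau> (\<alpha> + \<rho>)"
  shows "(T - qpow \<tau> (z + 2 - \<i> * lam) - 1 / qpow \<tau> (z + 2 - \<i> * lam)) * F \<alpha> \<rho> (- lam) (- (z + 2)) =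
    (qpow \<tau> \<rho> + 1 / qpow \<tau> \<rho> - qpow \<tau> (1 + \<i> * lam + z) - 1 / qpow \<tau> (1 + \<i> * lam + z))
      * F \<alpha> \<rho> (- lam) (- z)"
proof -
  define p1 where "p1 = P (4 + \<alpha> + \<rho> - \<i> * lam + z)"
  define p2 where "p2 = P (1 + \<rho> - \<i> * lam - z)"
  define p3 where "p3 = P (\<alpha> + \<rho> + \<i> * lam - z)"
  define p4 where "p4 = P (3 + \<rho> + \<i> * lam + z)"
  define a where "a = qpow \<tau> \<alpha>"
  define r where "r = qpow \<tau> \<rho>"
  define y where "y = qpow \<tau> (z + 2 - \<i> * lam)"
  define y' where "y' = qpow \<tau> (1 + \<i> * lam + z)"
  have nz0: "a \<noteq> 0" "r \<noteq> 0" "y \<noteq> 0" "y' \<noteq> 0"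
    by (simp_all add: a_def r_def y_def y'_def)
  have e: "P (2 + \<alpha> + \<rho> + \<i> * - lam - - z) = (1 - a * r * y) * p1"
    by (subst P_rec) (simp add: p1_def a_def r_def y_def qpow_add[symmetric] algebra_simps)
  have e2: "P (1 + \<rho> + \<i> * - lam + - (z + 2)) = (1 - r / y') * p2"
    by (subst P_rec) (simp add: p2_def r_def y'_def qpow_diff[symmetric] algebra_simps)
  have e3: "P (\<alpha> + \<rho> + \<i> * lam - z - 2) = (1 - a * r / y) * p3"
    by (subst P_rec) (simp add: p3_def a_def r_def y_def qpow_add[symmetric] qpow_diff[symmetric] algebra_simps)
  have e4: "P (1 + \<rho> + \<i> * lam + z) = (1 - r * y') * p4"
    by (subst P_rec) (simp add: p4_def r_def y'_def qpow_add[symmetric] algebra_simps)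
  have k: "qpow \<tau> (- (\<alpha> * - (z + 2) / 2)) = a * qpow \<tau> (- (\<alpha> * - z / 2))"
  proof -
    have "- (\<alpha> * - (z + 2) / 2) = \<alpha> + - (\<alpha> * - z / 2)"
      by (simp add: field_simps)
    then show ?thesis
      by (simp only: a_def qpow_add)
  qed
  have s: "2 + \<alpha> + \<rho> + \<i> * - lam - - (z + 2) = 4 + \<alpha> + \<rho> - \<i> * lam + z"
    "1 + \<rho> + \<i> * - lam + - z = 1 + \<rho> - \<i> * lam - z"
    "\<alpha> + \<rho> - \<i> * - lam + - z = \<alpha> + \<rho> + \<i> * lam - z"
    "1 + \<rho> - \<i> * - lam - - z = 1 + \<rho> + \<i> * lam + z"
    "\<alpha> + \<rho> - \<i> * - lam + - (z + 2) = \<alpha> + \<rho> + \<i> * lam - z - 2"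
    "1 + \<rho> - \<i> * - lam - - (z + 2) = 3 + \<rho> + \<i> * lam + z"
    by simp_all
  have nz: "1 - a * r / y \<noteq> 0" "p3 \<noteq> 0" "1 - r * y' \<noteq> 0" "p4 \<noteq> 0"
    using assms(1,2) unfolding e3 e4 by auto
  have T: "T - y - 1 / y = (1 - a * r / y) * (1 - a * r * y) / (a * r)"
    using nz0 by (simp add: T_def qpow_add a_def[symmetric] r_def[symmetric] field_simps)
  have R: "r + 1 / r - y' - 1 / y' = (1 - r / y') * (1 - r * y') / r"
    using nz0 by (simp add: field_simps)
  show ?thesis
    unfolding F_def s k e e2 e3 e4 y_def[symmetric] y'_def[symmetric] r_def[symmetric] T R
      p1_def[symmetric] p2_def[symmetric] p3_def[symmetric] p4_def[symmetric]
    using nz nz0 by simp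
qed

text \<open>A sign change of \<rho> exchanges a and b, one of \<alpha> + \<rho> exchanges c and d.
  Pairing the linear factors accordingly leaves only the symmetric sums \<open>R\<close> and
  \<open>T\<close>.\<close>

lemma coeff_eqs:
  fixes \<alpha> \<beta> \<rho> \<sigma> x :: complex
  defines "q \<equiv> qpow \<tau> 1" and "X \<equiv> qpow \<tau> x" and "b \<equiv> qpow \<tau> \<beta>" and "s \<equiv> qpow \<tau> \<sigma>"
    and "R \<equiv> qpow \<tau> \<rho> + 1 / qpow \<tau> \<rho>" and "T \<equiv> qpow \<tau> (\<alpha> + \<rho>) + 1 / qpow \<tau> (\<alpha> + \<rho>)"
  shows "B_coeff \<tau> \<beta> \<rho> \<sigma> x =
      (1 - q * s * X * R + q^2 * s^2 * X^2) * (1 - q * X * R / s + q^2 * X^2 / s^2)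
        / ((1 - X^2) * (1 - q^2 * X^2)) / b" (is ?B)
    and "A_coeff \<tau> \<alpha> \<beta> \<rho> \<sigma> x =
      (1 - q * s * X * R + q^2 * s^2 * X^2) * (1 - q * X / (b * s) * T + q^2 * X^2 / (b * s)^2)
        / ((1 - X^2) * (1 - q^2 * X^2))" (is ?A)
    and "A_coeff \<tau> \<alpha> \<beta> \<rho> \<sigma> (- x) =
      (1 - q * s / X * R + q^2 * s^2 / X^2) * (1 - q / X / (b * s) * T + q^2 / X^2 / (b * s)^2)
        / ((1 - 1 / X^2) * (1 - q^2 / X^2))" (is ?A')
    and "D_coeff \<tau> \<alpha> \<beta> \<rho> \<sigma> x =
      (1 - q * b * s * T / X + q^2 * (b * s)^2 / X^2) * (1 - q * T / (b * s) / X + q^2 / (b * s)^2 / X^2)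
        / ((1 - 1 / X^2) * (1 - q^2 / X^2)) / b" (is ?D)
proof -
  define r where "r = qpow \<tau> \<rho>"
  define t where "t = qpow \<tau> (\<alpha> + \<rho>)"
  have nz: "q \<noteq> 0" "X \<noteq> 0" "b \<noteq> 0" "s \<noteq> 0" "r \<noteq> 0" "t \<noteq> 0"
    by (simp_all add: q_def X_def b_def s_def r_def t_def)
  have t: "t = qpow \<tau> \<alpha> * r"
    by (simp add: t_def r_def qpow_add)
  have pair: "1 - c * (y + 1 / y) + c^2 = (1 - c * y) * (1 - c / y)" if "y \<noteq> 0" for c y :: complex
    using that by (simp add: field_simps power2_eq_square)
  note sq = power_mult_distrib power_divide
  have p1: "1 - q * s * X * R + q^2 * s^2 * X^2 = (1 - q * s * X * r) * (1 - q * s * X / r)"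
    using pair[OF nz(5), of "q * s * X"] by (simp add: R_def r_def sq)
  have p2: "1 - q * X * R / s + q^2 * X^2 / s^2 = (1 - q * X / s * r) * (1 - q * X / s / r)"
    using pair[OF nz(5), of "q * X / s"] by (simp add: R_def r_def sq)
  have p3: "1 - q * X / (b * s) * T + q^2 * X^2 / (b * s)^2
      = (1 - q * X / (b * s) * t) * (1 - q * X / (b * s) / t)"
    using pair[OF nz(6), of "q * X / (b * s)"] by (simp add: T_def t_def sq)
  have p4: "1 - q * s / X * R + q^2 * s^2 / X^2 = (1 - q * s / X * r) * (1 - q * s / X / r)"
    using pair[OF nz(5), of "q * s / X"] by (simp add: R_def r_def sq)
  have p5: "1 - q / X / (b * s) * T + q^2 / X^2 / (b * s)^2
      = (1 - q / X / (b * s) * t) * (1 - q / X / (b * s) / t)"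
    using pair[OF nz(6), of "q / X / (b * s)"] by (simp add: T_def t_def sq)
  have p6: "1 - q * b * s * T / X + q^2 * (b * s)^2 / X^2 = (1 - q * b * s / X * t) * (1 - q * b * s / X / t)"
    using pair[OF nz(6), of "q * b * s / X"] by (simp add: T_def t_def sq mult_ac)
  have p7: "1 - q * T / (b * s) / X + q^2 / (b * s)^2 / X^2
      = (1 - q / (b * s) / X * t) * (1 - q / (b * s) / X / t)"
    using pair[OF nz(6), of "q / (b * s) / X"] by (simp add: T_def t_def sq)
  note abs = qpow_add qpow_diff qpow_minus qpow_numeral qpow_numeral_mult q_def[symmetric]
    X_def[symmetric] b_def[symmetric] s_def[symmetric] r_def[symmetric]
  have d: "qpow \<tau> (2 * x) = X^2" "qpow \<tau> (2 + 2 * x) = q^2 * X^2"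
    "qpow \<tau> (2 * - x) = 1 / X^2" "qpow \<tau> (2 + 2 * - x) = q^2 / X^2"
    "qpow \<tau> (- 2 * x) = 1 / X^2" "qpow \<tau> (2 - 2 * x) = q^2 / X^2"
    using qpow_minus[of \<tau> "2 * x"] by (simp_all add: abs divide_inverse)
  have a: "qpow \<tau> (par_a \<rho> \<sigma> + x) = q * s * X * r" "qpow \<tau> (2 - par_a \<rho> \<sigma> + x) = q * X / s / r"
    "qpow \<tau> (par_b \<rho> \<sigma> + x) = q * s * X / r" "qpow \<tau> (2 - par_b \<rho> \<sigma> + x) = q * X / s * r"
    "qpow \<tau> (par_a \<rho> \<sigma> + - x) = q * s / X * r" "qpow \<tau> (par_b \<rho> \<sigma> + - x) = q * s / X / r"
    using nz by (simp_all add: par_a_def par_b_def abs field_simps power2_eq_square)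
  have c: "qpow \<tau> (par_c \<alpha> \<beta> \<rho> \<sigma> + x) = q * X / (b * s) * t"
    "qpow \<tau> (par_d \<alpha> \<beta> \<rho> \<sigma> + x) = q * X / (b * s) / t"
    "qpow \<tau> (par_c \<alpha> \<beta> \<rho> \<sigma> + - x) = q / X / (b * s) * t"
    "qpow \<tau> (par_d \<alpha> \<beta> \<rho> \<sigma> + - x) = q / X / (b * s) / t"
    "qpow \<tau> (par_c \<alpha> \<beta> \<rho> \<sigma> - x) = q / (b * s) / X * t"
    "qpow \<tau> (2 - par_c \<alpha> \<beta> \<rho> \<sigma> - x) = q * b * s / X / t"
    "qpow \<tau> (par_d \<alpha> \<beta> \<rho> \<sigma> - x) = q / (b * s) / X / t"
    "qpow \<tau> (2 - par_d \<alpha> \<beta> \<rho> \<sigma> - x) = q * b * s / X * t"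
    unfolding t using nz by (simp_all add: par_c_def par_d_def abs field_simps power2_eq_square)
  show ?B
    unfolding B_coeff_def Let_def a d p1 p2 qpow_minus b_def[symmetric] by (simp add: field_simps)
  show ?A ?A'
    unfolding A_coeff_def Let_def a c d p1 p3 p4 p5 by (simp_all add: mult_ac)
  show ?D
    unfolding D_coeff_def Let_def c d p6 p7 qpow_minus b_def[symmetric]
    by (simp only: divide_inverse mult_ac)
qed

text \<open>A rational multiple of the integrand, as in Gosper summation, with part of its
  denominator absorbed: \<open>V\<close> is \<open>F\<close> without the quadratic factor shared by
  F u and F (u + 2). The bracket before the reflected \<open>F\<close> is the one for which
  \<open>F_reflected_shift\<close> makes H (z + 2) a multiple of the reflected \<open>F\<close> at z
  itself.\<close>

definition H :: "complex \<Rightarrow> complex \<Rightarrow> complex \<Rightarrow> complex \<Rightarrow> complex \<Rightarrow> complex \<Rightarrow> complex \<Rightarrow> complex" where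
  "H \<alpha> \<beta> \<rho> \<sigma> lam x z =
     (let T = qpow \<tau> (\<alpha> + \<rho>) + 1 / qpow \<tau> (\<alpha> + \<rho>) in
       certificate (qpow \<tau> 1) (qpow \<tau> x) ((qpow \<tau> (\<i> * lam))^2) (qpow \<tau> \<beta>) (qpow \<tau> \<sigma>)
         (qpow \<tau> \<rho> + 1 / qpow \<tau> \<rho>) T (qpow \<tau> (\<i> * lam + x + z)) *
       ((T - qpow \<tau> (z - \<i> * lam) - 1 / qpow \<tau> (z - \<i> * lam)) * F \<alpha> \<rho> (- lam) (- z)) *
       V \<beta> \<sigma> lam (1 + x + z))"

text \<open>Both sides are \<open>W\<close> times the reflected \<open>F\<close> times the
  corresponding side of \<open>certificate_identity\<close>.\<close>

lemma telescoping:
  assumes gen: "1 - qpow \<tau> x ^ 2 \<noteq> 0" "1 - qpow \<tau> 1 ^ 2 * qpow \<tau> x ^ 2 \<noteq> 0" "qpow \<tau> x ^ 2 - qpow \<tau> 1 ^ 2 \<noteq> 0"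
    and nzP: "P (\<alpha> + \<rho> + \<i> * lam - z - 2) \<noteq> 0" "P (1 + \<rho> + \<i> * lam + z) \<noteq> 0"
      "P (\<beta> + \<sigma> - 2 - \<i> * lam + (1 + x + z)) \<noteq> 0" "P (\<sigma> - 1 - \<i> * lam - (1 + x + z)) \<noteq> 0"
  shows "B_coeff \<tau> \<beta> \<rho> \<sigma> x * (F \<beta> \<sigma> lam (1 + (x + 2) + z) * F \<alpha> \<rho> (- lam) (- z))
      + (C_coeff \<tau> \<alpha> \<beta> \<rho> \<sigma> x - E_val \<tau> \<beta> lam) * (F \<beta> \<sigma> lam (1 + x + z) * F \<alpha> \<rho> (- lam) (- z))
      + D_coeff \<tau> \<alpha> \<beta> \<rho> \<sigma> x * (F \<beta> \<sigma> lam (1 + (x - 2) + z) * F \<alpha> \<rho> (- lam) (- z))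
    = H \<alpha> \<beta> \<rho> \<sigma> lam x (z + 2) - H \<alpha> \<beta> \<rho> \<sigma> lam x z"
proof -
  define q where "q = qpow \<tau> 1"
  define X where "X = qpow \<tau> x"
  define L where "L = qpow \<tau> (\<i> * lam)"
  define M where "M = L^2"
  define w where "w = qpow \<tau> z"
  define b where "b = qpow \<tau> \<beta>"
  define s where "s = qpow \<tau> \<sigma>"
  define R where "R = qpow \<tau> \<rho> + 1 / qpow \<tau> \<rho>"
  define T where "T = qpow \<tau> (\<alpha> + \<rho>) + 1 / qpow \<tau> (\<alpha> + \<rho>)"
  define v where "v = qpow \<tau> (\<i> * lam + x + z)"
  define u where "u = 1 + x + z"
  define g where "g = F \<alpha> \<rho> (- lam) (- z)"
  have nz: "q \<noteq> 0" "X \<noteq> 0" "M \<noteq> 0" "b \<noteq> 0" "s \<noteq> 0" "v \<noteq> 0" "L \<noteq> 0" "w \<noteq> 0"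
    by (simp_all add: q_def X_def M_def L_def w_def b_def s_def v_def)
  have v: "v = L * X * w"
    by (simp add: v_def L_def X_def w_def qpow_add)
  note abs = qpow_add qpow_diff qpow_minus qpow_numeral qpow_numeral_mult q_def[symmetric]
    X_def[symmetric] b_def[symmetric] s_def[symmetric] L_def[symmetric] w_def[symmetric]
  have fac: "qpow \<tau> (2 + \<beta> + \<sigma> + \<i> * lam - u) = q * b * s * M / v"
    "qpow \<tau> (1 + \<sigma> + \<i> * lam + u) = q^2 * s * v"
    "qpow \<tau> (\<beta> + \<sigma> - 2 - \<i> * lam + u) = b * s * v / (q * M)"
    "qpow \<tau> (\<sigma> - 1 - \<i> * lam - u) = s / (q^2 * v)"
    "qpow \<tau> (\<beta> + \<sigma> + \<i> * lam - u) = b * s * M / (q * v)"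
    "qpow \<tau> (\<beta> + \<sigma> - \<i> * lam + u) = b * s * q * v / M"
    "qpow \<tau> (\<sigma> - 1 + \<i> * lam + u) = s * v"
    "qpow \<tau> (\<sigma> + 1 - \<i> * lam - u) = s / v"
    unfolding v M_def u_def using nz by (simp_all add: abs field_simps power2_eq_square)
  have gfac: "qpow \<tau> (z - \<i> * lam) = v / (M * X)" "1 / qpow \<tau> (z - \<i> * lam) = M * X / v"
    "qpow \<tau> (1 + \<i> * lam + z) = q * v / X" "1 / qpow \<tau> (1 + \<i> * lam + z) = X / (q * v)"
    unfolding v M_def using nz by (simp_all add: abs field_simps power2_eq_square)
  have E: "E_val \<tau> \<beta> lam = q / b * (M + 1 / M) - 1 - q^2 / b^2"
  proof -
    have "qpow \<tau> (2 * \<i> * lam) = M"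
      using qpow_numeral_mult[of \<tau> _ "\<i> * lam"] by (simp add: M_def L_def mult.assoc)
    moreover have "qpow \<tau> (- 2 * \<i> * lam) = 1 / M"
      using qpow_minus[of \<tau> "2 * \<i> * lam"] calculation by (simp add: divide_inverse)
    moreover have "qpow \<tau> (2 - 2 * \<beta>) = q^2 / b^2" "qpow \<tau> (1 - \<beta>) = q / b"
      by (simp_all add: abs)
    ultimately show ?thesis
      by (simp add: E_val_def)
  qed
  note cf = common_factors[where lam = lam, OF nzP(3,4)[folded u_def], unfolded fac qpow_minus b_def[symmetric]]
  have v2: "qpow \<tau> (\<i> * lam + x + (z + 2)) = q^2 * v"
    unfolding v by (simp add: abs)
  have u2: "1 + x + (z + 2) = u + 2"
    by (simp add: u_def)
  have H2: "H \<alpha> \<beta> \<rho> \<sigma> lam x (z + 2) =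
      certificate q X M b s R T (q^2 * v) * ((R - q * v / X - X / (q * v)) * g) * V \<beta> \<sigma> lam (u + 2)"
    unfolding H_def Let_def v2 u2 F_reflected_shift[OF nzP(1,2)] gfac
    unfolding R_def T_def q_def X_def M_def L_def b_def s_def g_def by simp
  have H0: "H \<alpha> \<beta> \<rho> \<sigma> lam x z =
      certificate q X M b s R T v * ((T - v / (M * X) - M * X / v) * g) * V \<beta> \<sigma> lam u"
    unfolding H_def Let_def gfac
    unfolding R_def T_def q_def X_def M_def L_def b_def s_def g_def v_def u_def by simp
  note id = certificate_identity[OF nz(1-6) gen[folded q_def X_def]
    coeff_eqs(1)[of \<beta> \<rho> \<sigma> x, folded q_def X_def b_def s_def R_def T_def]
    coeff_eqs(2-4)[of \<alpha> \<beta> \<rho> \<sigma> x, folded q_def X_def b_def s_def R_def T_def] E]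
  have u: "1 + (x + 2) + z = u + 2" "1 + (x - 2) + z = u - 2" "1 + x + z = u"
    by (simp_all add: u_def)
  have "B_coeff \<tau> \<beta> \<rho> \<sigma> x * (F \<beta> \<sigma> lam (u + 2) * g)
      + (C_coeff \<tau> \<alpha> \<beta> \<rho> \<sigma> x - E_val \<tau> \<beta> lam) * (F \<beta> \<sigma> lam u * g)
      + D_coeff \<tau> \<alpha> \<beta> \<rho> \<sigma> x * (F \<beta> \<sigma> lam (u - 2) * g) = W \<beta> \<sigma> lam u * g *
      (B_coeff \<tau> \<beta> \<rho> \<sigma> x / b * (1 - q * b * s * M / v) * (1 - b * s * M / (q * v))
          * (1 - b * s * v / (q * M)) * (1 - b * s * q * v / M)
        + (- A_coeff \<tau> \<alpha> \<beta> \<rho> \<sigma> x - A_coeff \<tau> \<alpha> \<beta> \<rho> \<sigma> (- x) - E_val \<tau> \<beta> lam)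
          * (1 - q * b * s * M / v) * (1 - q^2 * s * v) * (1 - b * s * v / (q * M)) * (1 - s / (q^2 * v))
        + D_coeff \<tau> \<alpha> \<beta> \<rho> \<sigma> x * b
          * (1 - q^2 * s * v) * (1 - s * v) * (1 - s / (q^2 * v)) * (1 - s / v))"
    unfolding cf C_coeff_def by (simp only: divide_inverse ring_distribs(1,2) mult_ac)
  also have "\<dots> = W \<beta> \<sigma> lam u * g *
      (certificate q X M b s R T (q^2 * v) * (R - q * v / X - X / (q * v)) / b
         * (1 - q * b * s * M / v) * (1 - b * s * v / (q * M))
       - certificate q X M b s R T v * (T - v / (M * X) - M * X / v)
         * (1 - q^2 * s * v) * (1 - s / (q^2 * v)))"
    unfolding id ..
  also have "\<dots> = H \<alpha> \<beta> \<rho> \<sigma> lam x (z + 2) - H \<alpha> \<beta> \<rho> \<sigma> lam x z"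
    unfolding H2 H0 cf by (simp add: divide_inverse algebra_simps)
  finally show ?thesis
    unfolding u g_def .
qed

text \<open>The bounds on the parameters keep the poles of \<open>V\<close> and of the reflected
  \<open>F\<close> away from -2 < Re z < 3. Any open strip inside it that contains 0 \<le> Re z
  \<le> 2 serves.\<close>

lemma holomorphic_H:
  assumes gen: "1 - qpow \<tau> x ^ 2 \<noteq> 0" "1 - qpow \<tau> 1 ^ 2 * qpow \<tau> x ^ 2 \<noteq> 0" "qpow \<tau> x ^ 2 - qpow \<tau> 1 ^ 2 \<noteq> 0"
    and par: "Im lam = 0" "Re x = 0" "Re (\<alpha> + \<rho>) \<ge> 3" "Re \<rho> \<ge> 3" "Re (\<beta> + \<sigma>) \<ge> 3" "Re \<sigma> \<ge> 3"
  shows "H \<alpha> \<beta> \<rho> \<sigma> lam x holomorphic_on {z. - 1 < Re z \<and> Re z < 5 / 2}"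
proof -
  define S where "S = {z. - 1 < Re z \<and> Re z < 5 / 2}"
  have "F \<alpha> \<rho> (- lam) \<circ> (\<lambda>z. - z) holomorphic_on S"
    by (rule holomorphic_on_compose_gen[OF _ holomorphic_F])
       (use par in \<open>auto simp: S_def intro!: holomorphic_intros\<close>)
  moreover have "V \<beta> \<sigma> lam \<circ> (\<lambda>z. 1 + x + z) holomorphic_on S"
    by (rule holomorphic_on_compose_gen[OF _ holomorphic_V])
       (use par in \<open>auto simp: S_def intro!: holomorphic_intros\<close>)
  moreover have "(\<lambda>z. certificate (qpow \<tau> 1) (qpow \<tau> x) M (qpow \<tau> \<beta>) (qpow \<tau> \<sigma>) R T (qpow \<tau> (\<i> * lam + x + z)))
      holomorphic_on S" if "M \<noteq> 0" for M R T
    by (intro holomorphic_certificate holomorphic_intros) (use gen that in auto)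
  ultimately show ?thesis
    unfolding H_def Let_def S_def[symmetric] o_def by (intro holomorphic_intros) auto
qed

lemma H_period:
  assumes "even \<alpha>" "even \<beta>"
  shows "H (of_int \<alpha>) (of_int \<beta>) \<rho> \<sigma> lam x (z + 1 / \<tau>) = H (of_int \<alpha>) (of_int \<beta>) \<rho> \<sigma> lam x z"
proof -
  have per: "qpow \<tau> (u + 1 / \<tau>) = qpow \<tau> u" for u
    using qpow_int_div_period[of \<tau> 1] by (simp add: qpow_add)
  have s: "\<i> * lam + x + (z + 1 / \<tau>) = \<i> * lam + x + z + 1 / \<tau>"
    "z + 1 / \<tau> - \<i> * lam = z - \<i> * lam + 1 / \<tau>" "1 + x + (z + 1 / \<tau>) = 1 + x + z + 1 / \<tau>"
    by simp_all
  have "F (of_int \<alpha>) \<rho> (- lam) (- (z + 1 / \<tau>)) = F (of_int \<alpha>) \<rho> (- lam) (- z)"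
    using F_period[OF assms(1), of \<rho> "- lam" "- (z + 1 / \<tau>)"] by simp
  then show ?thesis
    unfolding H_def Let_def s per V_period[OF assms(2)] by simp
qed

text \<open>The constant must not depend on x, so that it can be taken out of the whole difference
  equation. Scaling commutes with \<open>integral\<close> even without integrability, hence x is
  arbitrary here.\<close>

lemma phi_fun_eq:
  fixes \<alpha> \<beta> :: int and \<rho> \<sigma> lam :: real
  obtains K where "\<And>x. phi_fun \<tau> (of_int \<alpha>) (of_int \<beta>) (of_real \<rho>) (of_real \<sigma>) (of_real lam) x =
    K * integral {0..1::real} (\<lambda>y. F (of_int \<beta>) (of_real \<sigma>) (of_real lam) (1 + x + of_real y / \<tau>) *
                                  F (of_int \<alpha>) (of_real \<rho>) (- of_real lam) (- (of_real y / \<tau>)))"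
proof -
  obtain K1 where K1: "\<And>z. f_fun \<tau> (of_real lam) z (of_int \<beta>) (of_real \<sigma>) =
      K1 * F (of_int \<beta>) (of_real \<sigma>) (of_real lam) z"
    using f_fun_eq by blast
  obtain K2 where K2: "\<And>z. f_fun \<tau> (of_real lam) z (of_int \<alpha>) (of_real \<rho>) =
      K2 * F (of_int \<alpha>) (of_real \<rho>) (of_real lam) z"
    using f_fun_eq by blast
  have cnj_tau: "cnj \<tau> = - \<tau>"
    by (simp add: complex_eq_iff Re_tau)
  have "f_fun \<tau> (of_real lam) (1 + x + of_real y / \<tau>) (of_int \<beta>) (of_real \<sigma>) *
        cnj (f_fun \<tau> (of_real lam) (of_real y / \<tau>) (of_int \<alpha>) (of_real \<rho>)) =
      (K1 * cnj K2) * (F (of_int \<beta>) (of_real \<sigma>) (of_real lam) (1 + x + of_real y / \<tau>) *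
                       F (of_int \<alpha>) (of_real \<rho>) (- of_real lam) (- (of_real y / \<tau>)))" for x y
    unfolding K1 K2 complex_cnj_mult by (simp add: cnj_F cnj_tau)
  then have "phi_fun \<tau> (of_int \<alpha>) (of_int \<beta>) (of_real \<rho>) (of_real \<sigma>) (of_real lam) x =
    (K1 * cnj K2) * integral {0..1::real} (\<lambda>y. F (of_int \<beta>) (of_real \<sigma>) (of_real lam) (1 + x + of_real y / \<tau>) *
                                  F (of_int \<alpha>) (of_real \<rho>) (- of_real lam) (- (of_real y / \<tau>)))" for x
    unfolding phi_fun_def by (simp only: integral_mult_right)
  then show ?thesis
    by (rule that)
qed

end

section \<open>Integration of the telescoped equation over one period\<close>

theorem theorem4p4:
  fixes \<tau> x :: complex and lam \<rho> \<sigma> :: real and \<alpha> \<beta> :: int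
  assumes tau: "Re \<tau> = 0" "Im \<tau> > 0"
    and alpha: "even \<alpha>" "\<alpha> > 0"
    and beta: "even \<beta>" "\<beta> > 0"
    and rho: "\<rho> \<ge> 3"
    and sigma: "\<sigma> \<ge> 3"
    and x_imag: "Re x = 0"
    and x_generic: "qpow \<tau> (2 * x) \<noteq> 1"
  shows "B_coeff \<tau> (of_int \<beta>) (of_real \<rho>) (of_real \<sigma>) x
           * phi_fun \<tau> (of_int \<alpha>) (of_int \<beta>) (of_real \<rho>) (of_real \<sigma>) (of_real lam) (x + 2)
       + C_coeff \<tau> (of_int \<alpha>) (of_int \<beta>) (of_real \<rho>) (of_real \<sigma>) x
           * phi_fun \<tau> (of_int \<alpha>) (of_int \<beta>) (of_real \<rho>) (of_real \<sigma>) (of_real lam) x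
       + D_coeff \<tau> (of_int \<alpha>) (of_int \<beta>) (of_real \<rho>) (of_real \<sigma>) x
           * phi_fun \<tau> (of_int \<alpha>) (of_int \<beta>) (of_real \<rho>) (of_real \<sigma>) (of_real lam) (x - 2)
       = E_val \<tau> (of_int \<beta>) (of_real lam)
           * phi_fun \<tau> (of_int \<alpha>) (of_int \<beta>) (of_real \<rho>) (of_real \<sigma>) (of_real lam) x"
proof -
  interpret imaginary_tau \<tau>
    using tau by unfold_locales
  define l where "l = complex_of_real lam"
  define a where "a = complex_of_int \<alpha>"
  define b where "b = complex_of_int \<beta>"
  define r where "r = complex_of_real \<rho>"
  define s where "s = complex_of_real \<sigma>"
  have par: "Im l = 0" "Re a \<ge> 2" "Re b \<ge> 2" "Re r \<ge> 3" "Re s \<ge> 3"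
    using alpha beta rho sigma by (auto simp: l_def a_def b_def r_def s_def elim!: evenE)
  have norm_X: "cmod (qpow \<tau> x ^ 2) = 1"
    using x_imag by (simp add: norm_power norm_qpow)
  \<comment> \<open>The first denominator is non-zero by genericity of x; the other two cannot
    vanish because |q^(2x)| = 1 and |q^2| < 1.\<close>
  have gen: "1 - qpow \<tau> x ^ 2 \<noteq> 0" "1 - qpow \<tau> 1 ^ 2 * qpow \<tau> x ^ 2 \<noteq> 0" "qpow \<tau> x ^ 2 - qpow \<tau> 1 ^ 2 \<noteq> 0"
  proof -
    show "1 - qpow \<tau> x ^ 2 \<noteq> 0"
      using x_generic by (simp add: qpow_numeral_mult)
    have "cmod (qpow \<tau> 1 ^ 2 * qpow \<tau> x ^ 2) < 1"
      using norm_base norm_X by (simp add: norm_mult)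
    then show "1 - qpow \<tau> 1 ^ 2 * qpow \<tau> x ^ 2 \<noteq> 0"
      by auto
    show "qpow \<tau> x ^ 2 - qpow \<tau> 1 ^ 2 \<noteq> 0"
      using norm_base norm_X by auto
  qed
  define G where "G = (\<lambda>x' y::real. F b s l (1 + x' + of_real y / \<tau>) * F a r (- l) (- (of_real y / \<tau>)))"
  define h where "h = (\<lambda>z. H a b r s l x z)"
  have Re_y: "Re (of_real y / \<tau>) = 0" for y
    by (simp add: Re_divide tau)
  \<comment> \<open>Re (1 + x') lies in [-1, 3], while \<open>F b s l\<close> is holomorphic at
    least for -5 < Re z < 4.\<close>
  have intG: "G x' integrable_on {0..1}" if "\<bar>Re x'\<bar> \<le> 2" for x'
  proof -
    have "continuous_on {0..1} (G x')"
      unfolding G_def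
      by (intro continuous_intros tau_nonzero
            continuous_on_compose2[OF holomorphic_on_imp_continuous_on[OF holomorphic_F]])
         (use that par Re_y in auto)
    then show ?thesis
      by (rule integrable_continuous_real)
  qed
  have "(h \<circ> (\<lambda>y. z + of_real y / \<tau>)) integrable_on {0..1}" if "Re z = 0 \<or> Re z = 2" for z
  proof -
    have "continuous_on {0..1} (h \<circ> (\<lambda>y. z + of_real y / \<tau>))"
      unfolding h_def o_def
      by (intro continuous_intros tau_nonzero
            continuous_on_compose2[OF holomorphic_on_imp_continuous_on[OF holomorphic_H[OF gen]]])
         (use that par Re_y x_imag in auto)
    then show ?thesis
      by (rule integrable_continuous_real)
  qed
  from this[of 0] this[of 2]
  have inth: "(\<lambda>y::real. h (of_real y / \<tau>)) integrable_on {0..1}"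
      "(\<lambda>y::real. h (2 + of_real y / \<tau>)) integrable_on {0..1}"
    by (simp_all add: o_def)
  define J where "J = (\<lambda>x'. integral {0..1} (G x'))"
  have "((\<lambda>y. B_coeff \<tau> b r s x * G (x + 2) y + (C_coeff \<tau> a b r s x - E_val \<tau> b l) * G x y
        + D_coeff \<tau> a b r s x * G (x - 2) y) has_integral
      B_coeff \<tau> b r s x * J (x + 2) + (C_coeff \<tau> a b r s x - E_val \<tau> b l) * J x
        + D_coeff \<tau> a b r s x * J (x - 2)) {0..1}"
    unfolding J_def by (intro has_integral_add has_integral_mult_right integrable_integral intG)
      (use x_imag in auto)
  moreover have "B_coeff \<tau> b r s x * G (x + 2) y + (C_coeff \<tau> a b r s x - E_val \<tau> b l) * G x y
        + D_coeff \<tau> a b r s x * G (x - 2) y = h (2 + of_real y / \<tau>) - h (of_real y / \<tau>)" for y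
    unfolding G_def h_def add.commute[of 2]
    \<comment> \<open>The real parts of the four arguments of \<open>P\<close> are at least 3, 4, 4
      and 1; the last one is Re s - 2.\<close>
    by (rule telescoping[OF gen]; rule P_nonzero) (use par Re_y x_imag in auto)
  ultimately have "B_coeff \<tau> b r s x * J (x + 2) + (C_coeff \<tau> a b r s x - E_val \<tau> b l) * J x
        + D_coeff \<tau> a b r s x * J (x - 2)
      = integral {0..1} (\<lambda>y::real. h (2 + of_real y / \<tau>) - h (of_real y / \<tau>))"
    by (simp add: has_integral_iff)
  also have "\<dots> = integral {0..1} (\<lambda>y::real. h (2 + of_real y / \<tau>)) - integral {0..1} (\<lambda>y::real. h (of_real y / \<tau>))"
    using inth by (intro Henstock_Kurzweil_Integration.integral_diff)
  also have "\<dots> = 0"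
  proof -
    have "integral {0..1} (\<lambda>y::real. h (2 + of_real y * (1 / \<tau>))) =
        integral {0..1} (\<lambda>y::real. h (0 + of_real y * (1 / \<tau>)))"
    proof (rule integral_periodic_line_shift)
      show "h holomorphic_on {z. - 1 < Re z \<and> Re z < 5 / 2}"
        unfolding h_def by (rule holomorphic_H[OF gen]) (use par x_imag in auto)
      show "h (z + 1 / \<tau>) = h z" for z
        unfolding h_def a_def b_def by (rule H_period[OF alpha(1) beta(1)])
    qed (use Re_y[of 1] in auto)
    then show ?thesis
      by simp
  qed
  finally have J: "B_coeff \<tau> b r s x * J (x + 2) + C_coeff \<tau> a b r s x * J x
      + D_coeff \<tau> a b r s x * J (x - 2) = E_val \<tau> b l * J x"
    by (simp add: algebra_simps)
  obtain K where K: "\<And>x'. phi_fun \<tau> a b r s l x' = K * J x'"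
    using phi_fun_eq[of \<alpha> \<beta> \<rho> \<sigma> lam] unfolding J_def G_def l_def a_def b_def r_def s_def by blast
  have "B_coeff \<tau> b r s x * phi_fun \<tau> a b r s l (x + 2) + C_coeff \<tau> a b r s x * phi_fun \<tau> a b r s l x
      + D_coeff \<tau> a b r s x * phi_fun \<tau> a b r s l (x - 2)
      = K * (B_coeff \<tau> b r s x * J (x + 2) + C_coeff \<tau> a b r s x * J x
             + D_coeff \<tau> a b r s x * J (x - 2))"
    unfolding K by (simp add: algebra_simps)
  also have "\<dots> = E_val \<tau> b l * phi_fun \<tau> a b r s l x"
    unfolding K J by simp
  finally show ?thesis
    unfolding l_def a_def b_def r_def s_def .
qed

end
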